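(* Let $n\in\mathbb{N}$ with $n\ge 1$ and let $M=(m_{i,j})_{i,j=1}^n\in\mathbb{R}^{n\times n}$. Then there is a unique decomposition $$M = M_V + M_0 + (\operatorname{wt} M)\,\mathcal{E}_n,$$ where $M_0\in S_n$ has weight $0$ and $M_V\in V_n$. Moreover $M_V = a1_n^T+1_nb^T$, where the entries of the vectors $a,b\in\mathbb{R}^n$ are given by $$a_i = \frac{1}{n}\sum_{j=1}^n m_{i,j} - \operatorname{wt} M\quad (i\in\{1,\dots,n\}),\qquad b_j = \frac{1}{n}\sum_{i=1}^n m_{i,j} - \operatorname{wt} M\quad (j\in\{1,\dots,n\}).$$ In particular, if $M$ is an integer matrix then the vectors $n^2a$ and $n^2b$ have integer entries.
   Context: Notation: $1_n\in\mathbb{R}^n$ is the column vector with all entries equal to $1$; $\mathcal{E}_n = 1_n1_n^T$ is the $n\times n$ matrix with all entries equal to $1$. For $M=(m_{i,j})\in\mathbb{R}^{n\times n}$, $\operatorname{wt} M = \frac{1}{n^2}\sum_{i,j=1}^n m_{i,j}$. $S_n$ is the space of matrices $M\in\mathbb{R}^{n\times n}$ for which there is a number $w\in\mathbb{R}$ (the weight of $M$) such that $\sum_{j=1}^n m_{i,j}=\sum_{j=1}^n m_{j,i}=nw$ for all $i\in\{1,\dots,n\}$. (For $M\in S_n$ the weight equals $\operatorname{wt}M$.) $V_n$ is the space of matrices $M\in\mathbb{R}^{n\times n}$ such that $m_{i,j}+m_{k,l}=m_{i,l}+m_{k,j}$ for all $i,j,k,l\in\{1,\dots,n\}$ and $\sum_{i,j=1}^n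 m_{i,j}=0$. *)

theory Defs
  imports "HOL-Analysis.Analysis"
begin

text \<open>The entry in row \<open>i\<close> and column \<open>j\<close> of \<open>M\<close> is \<open>M $ i $ j\<close>, the index set being the finite
  type \<open>'n\<close> with \<open>n = CARD('n) \<ge> 1\<close>. The vector \<open>1 :: real ^ 'n\<close> has all entries equal to 1.
  A column vector is an \<open>n \<times> 1\<close> matrix and a row vector a \<open>1 \<times> n\<close> matrix,
  i.e. of type \<open>real ^ 1 ^ 'n\<close> and \<open>real ^ 'n ^ 1\<close> respectively.\<close>

definition outer :: "real ^ 'n \<Rightarrow> real ^ 'n \<Rightarrow> real ^ 'n ^ 'n" where
  "outer x y = (columnvector x :: real ^ 1 ^ 'n) ** (rowvector y :: real ^ 'n ^ 1)"

definition ones_mat :: "real ^ 'n ^ 'n" where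
  "ones_mat = outer 1 1"

definition wt :: "real ^ 'n ^ 'n \<Rightarrow> real" where
  "wt M = (1 / (real CARD('n))\<^sup>2) * (\<Sum>i\<in>UNIV. \<Sum>j\<in>UNIV. M $ i $ j)"

definition has_weight :: "real ^ 'n ^ 'n \<Rightarrow> real \<Rightarrow> bool" where
  "has_weight M w \<longleftrightarrow>
    (\<forall>i. (\<Sum>j\<in>UNIV. M $ i $ j) = real CARD('n) * w \<and>
         (\<Sum>j\<in>UNIV. M $ j $ i) = real CARD('n) * w)"

definition S_space :: "(real ^ 'n ^ 'n) set" where
  "S_space = {M. \<exists>w. has_weight M w}"

definition V_space :: "(real ^ 'n ^ 'n) set" where
  "V_space = {M. (\<forall>i j k l. M $ i $ j + M $ k $ l = M $ i $ l + M $ k $ j) \<and>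
                 (\<Sum>i\<in>UNIV. \<Sum>j\<in>UNIV. M $ i $ j) = 0}"

definition is_decomposition ::
    "real ^ 'n ^ 'n \<Rightarrow> real ^ 'n ^ 'n \<Rightarrow> real ^ 'n ^ 'n \<Rightarrow> bool" where
  "is_decomposition M MV M0 \<longleftrightarrow>
    MV \<in> V_space \<and> M0 \<in> S_space \<and> has_weight M0 0 \<and>
    M = MV + M0 + wt M *\<^sub>R ones_mat"

end

theory Submission
  imports Defs
begin

text \<open>A matrix in \<open>V\<^sub>n\<close> is determined by its row and column sums: summing
  \<open>m\<^sub>i\<^sub>j + m\<^sub>k\<^sub>l = m\<^sub>i\<^sub>l + m\<^sub>k\<^sub>j\<close> over all \<open>k\<close> and \<open>l\<close> expresses \<open>n\<^sup>2 m\<^sub>i\<^sub>j\<close> through them.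
  Since \<open>M\<^sub>0\<close> has vanishing row and column sums, those of \<open>M\<^sub>V\<close> are the ones of
  \<open>M - (wt M) E\<^sub>n\<close>, which forces the formulas for \<open>a\<close> and \<open>b\<close>.\<close>

lemma outer_nth [simp]: "outer x y $ i $ j = x $ i * y $ j"
  by (simp add: outer_def matrix_matrix_mult_def columnvector_def rowvector_def)

lemma ones_mat_nth [simp]: "ones_mat $ i $ j = 1"
  by (simp add: ones_mat_def)

lemma card_square_mult_wt:
  fixes M :: "real ^ 'n ^ 'n"
  shows "(real CARD('n))\<^sup>2 * wt M = (\<Sum>i\<in>UNIV. \<Sum>j\<in>UNIV. M $ i $ j)"
  by (simp add: wt_def)

lemma V_space_nth:
  fixes M :: "real ^ 'n ^ 'n"
  assumes "M \<in> V_space"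
  shows "real CARD('n) * M $ i $ j = (\<Sum>l\<in>UNIV. M $ i $ l) + (\<Sum>k\<in>UNIV. M $ k $ j)"
proof -
  let ?n = "real CARD('n)"
  have "(\<Sum>k\<in>UNIV. \<Sum>l\<in>UNIV. M $ i $ j + M $ k $ l) = (\<Sum>k\<in>UNIV. \<Sum>l\<in>UNIV. M $ i $ l + M $ k $ j)"
    using assms by (intro sum.cong refl) (simp add: V_space_def)
  moreover have "(\<Sum>k\<in>UNIV. \<Sum>l\<in>UNIV. M $ k $ l) = 0"
    using assms by (simp add: V_space_def)
  \<comment> \<open>The common factor \<open>?n\<close> is positive because index types are
    nonempty, so it cancels.\<close>
  ultimately have "?n * (?n * M $ i $ j) = ?n * ((\<Sum>l\<in>UNIV. M $ i $ l) + (\<Sum>k\<in>UNIV. M $ k $ j))"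
    by (simp add: sum.distrib sum_distrib_left distrib_left)
  then show ?thesis
    by simp
qed

text \<open>This is the vector a, and \<open>col_dev\<close> is b; the bodies repeat the terms of
  the theorem so that these can be folded at the end.\<close>

definition row_dev :: "real ^ 'n ^ 'n \<Rightarrow> real ^ 'n" where
  "row_dev M = (\<chi> i. (1 / real CARD('n)) * (\<Sum>j\<in>UNIV. M $ i $ j) - wt M)"

definition col_dev :: "real ^ 'n ^ 'n \<Rightarrow> real ^ 'n" where
  "col_dev M = (\<chi> j. (1 / real CARD('n)) * (\<Sum>i\<in>UNIV. M $ i $ j) - wt M)"

lemma card_mult_row_dev:
  fixes M :: "real ^ 'n ^ 'n"
  shows "real CARD('n) * row_dev M $ i = (\<Sum>j\<in>UNIV. M $ i $ j) - real CARD('n) * wt M"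
  by (simp add: row_dev_def right_diff_distrib)

text \<open>Transposition swaps rows with columns and preserves \<open>wt\<close>, so facts about b
  follow from those about a.\<close>

lemma col_dev_eq_row_dev_transpose: "col_dev M = row_dev (transpose M)"
proof -
  have "wt (transpose M) = wt M"
    unfolding wt_def transpose_def by (simp, rule sum.swap)
  then show ?thesis
    by (simp add: col_dev_def row_dev_def transpose_def)
qed

lemma card_mult_col_dev:
  fixes M :: "real ^ 'n ^ 'n"
  shows "real CARD('n) * col_dev M $ j = (\<Sum>i\<in>UNIV. M $ i $ j) - real CARD('n) * wt M"
  by (simp add: col_dev_def right_diff_distrib)

text \<open>The average of the row means is \<open>wt M\<close>, so the deviations from it
  cancel.\<close>

lemma sum_row_dev: "(\<Sum>i\<in>UNIV. row_dev M $ i) = 0"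
  for M :: "real ^ 'n ^ 'n"
proof -
  let ?n = "real CARD('n)"
  have "?n * (\<Sum>i\<in>UNIV. row_dev M $ i) = (\<Sum>i\<in>UNIV. \<Sum>j\<in>UNIV. M $ i $ j) - ?n * (?n * wt M)"
    by (simp add: sum_distrib_left card_mult_row_dev sum_subtractf)
  also have "\<dots> = 0"
    by (simp add: card_square_mult_wt [symmetric] power2_eq_square)
  finally show ?thesis
    by simp
qed

lemma sum_col_dev: "(\<Sum>j\<in>UNIV. col_dev M $ j) = 0"
  by (simp add: col_dev_eq_row_dev_transpose sum_row_dev)

text \<open>Entries of the form a_i + b_j satisfy the exchange identity; the total is n times the
  sum of all a_i and b_j, hence zero.\<close>

lemma outer_add_outer_in_V_space:
  fixes a b :: "real ^ 'n"
  assumes "(\<Sum>i\<in>UNIV. a $ i) = 0" "(\<Sum>j\<in>UNIV. b $ j) = 0"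
  shows "outer a 1 + outer 1 b \<in> V_space"
  using assms by (simp add: V_space_def sum.distrib sum_distrib_left [symmetric])

lemma is_decomposition_exists:
  fixes M :: "real ^ 'n ^ 'n"
  defines "MV \<equiv> outer (row_dev M) 1 + outer 1 (col_dev M)"
  shows "is_decomposition M MV (M - MV - wt M *\<^sub>R ones_mat)"
proof -
  \<comment> \<open>As the entries of b sum to zero, row i of \<open>MV\<close> sums to n a_i, which
    is the row sum of \<open>M\<close> minus n \<open>wt M\<close>; columns are analogous.\<close>
  have "has_weight (M - MV - wt M *\<^sub>R ones_mat) 0"
    by (simp add: has_weight_def MV_def sum_subtractf sum.distrib
        sum_row_dev sum_col_dev card_mult_row_dev card_mult_col_dev)
  moreover have "MV \<in> V_space"
    unfolding MV_def by (intro outer_add_outer_in_V_space sum_row_dev sum_col_dev)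
  ultimately show ?thesis
    by (auto simp: is_decomposition_def S_space_def)
qed

lemma is_decomposition_unique:
  fixes M :: "real ^ 'n ^ 'n"
  assumes "is_decomposition M MV M0"
  shows "MV = outer (row_dev M) 1 + outer 1 (col_dev M)"
proof -
  let ?n = "real CARD('n)"
  have V: "MV \<in> V_space" and M0: "has_weight M0 0"
    and M: "M = MV + M0 + wt M *\<^sub>R ones_mat"
    using assms by (auto simp: is_decomposition_def)
  have nth: "MV $ i $ j = M $ i $ j - M0 $ i $ j - wt M" for i j
    using arg_cong [OF M, of "\<lambda>A. A $ i $ j"] by simp
  \<comment> \<open>By \<open>V_space_nth\<close> only row and column sums of \<open>MV\<close>
    matter, and to these \<open>M0\<close> contributes nothing.\<close>
  have "?n * MV $ i $ j = ?n * (row_dev M $ i + col_dev M $ j)" for i j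
    using M0 unfolding V_space_nth [OF V]
    by (simp add: nth has_weight_def sum_subtractf distrib_left card_mult_row_dev card_mult_col_dev)
  then show ?thesis
    by (simp add: vec_eq_iff)
qed

text \<open>One factor n clears the row mean, while \<open>wt M\<close> needs both.\<close>

lemma row_dev_Ints:
  fixes M :: "real ^ 'n ^ 'n"
  assumes "\<And>i j. M $ i $ j \<in> \<int>"
  shows "(real CARD('n))\<^sup>2 * row_dev M $ i \<in> \<int>"
proof -
  let ?n = "real CARD('n)"
  have "?n\<^sup>2 * row_dev M $ i = ?n * (?n * row_dev M $ i)"
    by (simp add: power2_eq_square)
  also have "\<dots> = ?n * (\<Sum>j\<in>UNIV. M $ i $ j) - ?n\<^sup>2 * wt M"
    unfolding card_mult_row_dev by (simp add: right_diff_distrib power2_eq_square)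
  also have "\<dots> \<in> \<int>"
    unfolding card_square_mult_wt using assms
    by (intro Ints_diff Ints_mult Ints_of_nat Ints_sum)
  finally show ?thesis .
qed

lemma col_dev_Ints:
  fixes M :: "real ^ 'n ^ 'n"
  assumes "\<And>i j. M $ i $ j \<in> \<int>"
  shows "(real CARD('n))\<^sup>2 * col_dev M $ j \<in> \<int>"
  unfolding col_dev_eq_row_dev_transpose
  by (rule row_dev_Ints) (simp add: transpose_def assms)

theorem theorem2p3:
  fixes M :: "real ^ 'n ^ 'n"
  shows "(\<exists>!(MV, M0). is_decomposition M MV M0) \<and>
    (let n = real CARD('n);
         a = (\<chi> i. (1 / n) * (\<Sum>j\<in>UNIV. M $ i $ j) - wt M) :: real ^ 'n;
         b = (\<chi> j. (1 / n) * (\<Sum>i\<in>UNIV. M $ i $ j) - wt M) :: real ^ 'n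
     in (\<forall>MV M0. is_decomposition M MV M0 \<longrightarrow> MV = outer a 1 + outer 1 b) \<and>
        ((\<forall>i j. M $ i $ j \<in> \<int>) \<longrightarrow>
          (\<forall>i. (n\<^sup>2 *\<^sub>R a) $ i \<in> \<int>) \<and> (\<forall>j. (n\<^sup>2 *\<^sub>R b) $ j \<in> \<int>)))"
proof -
  have "\<exists>!(MV, M0). is_decomposition M MV M0"
  proof (rule ex1I, unfold split_beta)
    let ?MV = "outer (row_dev M) 1 + outer 1 (col_dev M)"
    let ?p = "(?MV, M - ?MV - wt M *\<^sub>R ones_mat)"
    show "is_decomposition M (fst ?p) (snd ?p)"
      using is_decomposition_exists by simp
    fix q
    assume q: "is_decomposition M (fst q) (snd q)"
    then have "M = fst q + snd q + wt M *\<^sub>R ones_mat"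
      by (simp add: is_decomposition_def)
    \<comment> \<open>The second component is the remainder, so uniqueness of the first
      suffices.\<close>
    then have "snd q = M - fst q - wt M *\<^sub>R ones_mat"
      by (simp add: algebra_simps)
    with is_decomposition_unique [OF q] show "q = ?p"
      by (simp add: prod_eq_iff)
  qed
  then show ?thesis
    unfolding Let_def row_dev_def [symmetric] col_dev_def [symmetric]
    using is_decomposition_unique row_dev_Ints [of M] col_dev_Ints [of M] by auto
qed

end
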